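(* For each odd integer $n\geq 3$, $d_{\mathrm{cb}}\big(W_n^-,\mathrm{conv}(\mathrm{Aut}(M_n(\mathbb{C})))\big)=\frac{2}{n}$.
   Context: $W_n^-(x)=\frac{1}{n-1}(\mathrm{Tr}_n(x)1_n-x^t)$ is the Holevo–Werner channel on $M_n(\mathbb{C})$ ($\mathrm{Tr}_n$ the non-normalized trace, $x^t$ the transpose). $\mathrm{Aut}(M_n(\mathbb{C}))$ is the set of maps $x\mapsto u^*xu$ with $u$ unitary, $\mathrm{conv}$ denotes convex hull, and $d_{\mathrm{cb}}(T,\mathcal{C})=\inf_{R\in\mathcal{C}}\|T-R\|_{\mathrm{cb}}$. *)

theory Defs
  imports "HOL-Analysis.Analysis"
begin

type_synonym 'n cmat = "complex^'n^'n"

definition mtrace :: "'n::finite cmat \<Rightarrow> complex" where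
  "mtrace x = (\<Sum>i\<in>UNIV. x $ i $ i)"

definition adj :: "'n::finite cmat \<Rightarrow> 'n cmat" where
  "adj u = (\<chi> i j. cnj (u $ j $ i))"

definition unitary :: "'n::finite cmat \<Rightarrow> bool" where
  "unitary u \<longleftrightarrow> adj u ** u = mat 1 \<and> u ** adj u = mat 1"

definition werner_minus :: "'n::finite cmat \<Rightarrow> 'n cmat" where
  "werner_minus x = (1 / (real CARD('n) - 1)) *\<^sub>R (mat (mtrace x) - transpose x)"

definition Aut :: "('n::finite cmat \<Rightarrow> 'n cmat) set" where
  "Aut = {(\<lambda>x. adj u ** x ** u) | u. unitary u}"

definition conv_maps :: "('n::finite cmat \<Rightarrow> 'n cmat) set \<Rightarrow> ('n cmat \<Rightarrow> 'n cmat) set" where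
  "conv_maps S = {(\<lambda>x. \<Sum>i\<in>I. c i *\<^sub>R f i x) | (I::nat set) c f.
      finite I \<and> I \<noteq> {} \<and> (\<forall>i\<in>I. 0 \<le> c i \<and> f i \<in> S) \<and> (\<Sum>i\<in>I. c i) = 1}"

text \<open>Elements of M_k(M_n): k x k block matrices with n x n blocks, X i j for i,j < k.
  They act on (C^n)^k; vectors are v i for i < k, with Euclidean norm.\<close>
definition bnorm :: "nat \<Rightarrow> (nat \<Rightarrow> complex^'n::finite) \<Rightarrow> real" where
  "bnorm k v = sqrt (\<Sum>i<k. (norm (v i))\<^sup>2)"

definition bapply :: "nat \<Rightarrow> (nat \<Rightarrow> nat \<Rightarrow> 'n::finite cmat) \<Rightarrow> (nat \<Rightarrow> complex^'n) \<Rightarrow> nat \<Rightarrow> complex^'n" where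
  "bapply k X v = (\<lambda>i. \<Sum>j<k. X i j *v v j)"

definition bopnorm :: "nat \<Rightarrow> (nat \<Rightarrow> nat \<Rightarrow> 'n::finite cmat) \<Rightarrow> real" where
  "bopnorm k X = Sup {bnorm k (bapply k X v) | v. bnorm k v \<le> 1}"

definition cb_norm :: "('n::finite cmat \<Rightarrow> 'n cmat) \<Rightarrow> real" where
  "cb_norm T = Sup {bopnorm k (\<lambda>i j. T (X i j)) | k X. 1 \<le> k \<and> bopnorm k X \<le> 1}"

definition d_cb :: "('n::finite cmat \<Rightarrow> 'n cmat) \<Rightarrow> ('n cmat \<Rightarrow> 'n cmat) set \<Rightarrow> real" where
  "d_cb T C = Inf {cb_norm (\<lambda>x. T x - R x) | R. R \<in> C}"

end

theory Submission
  imports Defs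
begin

text \<open>Pairing a map with the flip matrix and the maximally entangled vector yields a functional of
  norm at most \<open>n\<close> for the cb norm. It takes the value \<open>-n\<close> at \<open>W\<^sub>n\<^sup>-\<close> and
  \<open>Re (\<Sum>a b. u\<^sub>a\<^sub>b * cnj u\<^sub>b\<^sub>a)\<close> at \<open>x \<mapsto> u\<^sup>* x u\<close>. The latter is at least \<open>2 - n\<close> for odd \<open>n\<close>, because
  the antisymmetric part of \<open>u\<close> is then singular; hence the distance is at least \<open>2/n\<close>.

  Conversely, averaging over unitaries that are antisymmetric apart from a fixed point of a
  near-perfect matching of the indices gives \<open>(1 - 1/n) W\<^sub>n\<^sup>- + (1/n) E\<close> in the convex hull, where
  \<open>E\<close> is the projection onto the diagonal. Its difference from \<open>W\<^sub>n\<^sup>-\<close> is \<open>(1/n) (W\<^sub>n\<^sup>- - E)\<close>, and both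
  \<open>W\<^sub>n\<^sup>-\<close> and \<open>E\<close> are unital and completely positive, so its cb norm is at most \<open>2/n\<close>.\<close>

subsection \<open>Completely bounded maps\<close>

lemma bnorm_eq_L2_set: "bnorm k v = L2_set (\<lambda>i. norm (v i)) {..<k}"
  by (simp add: bnorm_def L2_set_def)

lemma bnorm_nonneg: "0 \<le> bnorm k v"
  by (simp add: bnorm_def sum_nonneg)

lemma power2_bnorm: "(bnorm k v)\<^sup>2 = (\<Sum>i<k. v i \<bullet> v i)"
  by (simp add: bnorm_def sum_nonneg power2_norm_eq_inner)

lemma sum_inner_le_bnorm: "(\<Sum>i<k. v i \<bullet> w i) \<le> bnorm k v * bnorm k w"
proof -
  have "(\<Sum>i<k. v i \<bullet> w i) \<le> (\<Sum>i<k. \<bar>norm (v i)\<bar> * \<bar>norm (w i)\<bar>)"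
    by (intro sum_mono) (simp add: norm_cauchy_schwarz)
  also have "\<dots> \<le> bnorm k v * bnorm k w"
    unfolding bnorm_eq_L2_set by (rule L2_set_mult_ineq)
  finally show ?thesis .
qed

lemma bnorm_triangle: "bnorm k (\<lambda>i. v i + w i) \<le> bnorm k v + bnorm k w"
proof -
  have "bnorm k (\<lambda>i. v i + w i) \<le> L2_set (\<lambda>i. norm (v i) + norm (w i)) {..<k}"
    unfolding bnorm_eq_L2_set by (intro L2_set_mono) (auto simp: norm_triangle_ineq)
  also have "\<dots> \<le> bnorm k v + bnorm k w"
    unfolding bnorm_eq_L2_set by (rule L2_set_triangle_ineq)
  finally show ?thesis .
qed

lemma bnorm_scaleR: "bnorm k (\<lambda>i. c *\<^sub>R v i) = \<bar>c\<bar> * bnorm k v"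
  unfolding bnorm_eq_L2_set by (simp add: L2_set_right_distrib)

lemma norm_le_bnorm: "i < k \<Longrightarrow> norm (v i) \<le> bnorm k v"
  unfolding bnorm_eq_L2_set by (rule member_le_L2_set) auto

lemma bnorm_le_sum: "bnorm k v \<le> (\<Sum>i<k. norm (v i))"
  unfolding bnorm_eq_L2_set by (rule L2_set_le_sum) auto

lemma scaleR_matrix_vector_mult: "(c *\<^sub>R A) *v x = c *\<^sub>R (A *v (x :: complex^'n))"
  by (simp add: vec_eq_iff matrix_vector_mult_def scaleR_sum_right)

lemma matrix_vector_mult_scaleR: "A *v (c *\<^sub>R x) = c *\<^sub>R (A *v (x :: complex^'n))"
  by (simp add: vec_eq_iff matrix_vector_mult_def scaleR_sum_right)

text \<open>On matrices \<open>norm\<close> is the Hilbert-Schmidt norm, so Cauchy-Schwarz in each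
  row suffices. The estimate serves twice: to keep operator norms finite, and to bound
  \<open>u + transpose u\<close> from below.\<close>

lemma norm_matrix_vector_mult_le:
  fixes A :: "complex^'n^'m"
  shows "norm (A *v x) \<le> norm A * norm x"
proof -
  have row: "norm ((A *v x) $ i) \<le> norm (A $ i) * norm x" for i
  proof -
    have "norm ((A *v x) $ i) \<le> (\<Sum>j\<in>UNIV. \<bar>norm (A $ i $ j)\<bar> * \<bar>norm (x $ j)\<bar>)"
      unfolding matrix_vector_mult_def by (auto intro: sum_norm_le simp: norm_mult)
    also have "\<dots> \<le> norm (A $ i) * norm x"
      unfolding norm_vec_def by (rule L2_set_mult_ineq)
    finally show ?thesis .
  qed
  have "norm (A *v x) \<le> L2_set (\<lambda>i. norm (A $ i) * norm x) UNIV"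
    unfolding norm_vec_def[of "A *v x"] by (intro L2_set_mono row) auto
  also have "\<dots> = norm A * norm x"
    by (simp add: norm_vec_def[of A] L2_set_left_distrib)
  finally show ?thesis .
qed

section \<open>Operator norms of block matrices\<close>

lemma bapply_scaleR: "bapply k X (\<lambda>i. c *\<^sub>R v i) = (\<lambda>i. c *\<^sub>R bapply k X v i)"
  by (simp add: bapply_def matrix_vector_mult_scaleR scaleR_sum_right)

text \<open>A real \<open>Sup\<close> can be used only for sets bounded above; the sum of the
  Hilbert-Schmidt norms of all blocks is a crude but sufficient bound.\<close>

lemma bdd_above_bopnorm:
  fixes X :: "nat \<Rightarrow> nat \<Rightarrow> 'n::finite cmat"
  shows "bdd_above {bnorm k (bapply k X v) | v. bnorm k v \<le> 1}"
proof (rule bdd_aboveI, safe)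
  fix v :: "nat \<Rightarrow> complex^'n" assume v: "bnorm k v \<le> 1"
  have "bnorm k (bapply k X v) \<le> (\<Sum>i<k. norm (bapply k X v i))"
    by (rule bnorm_le_sum)
  also have "\<dots> \<le> (\<Sum>i<k. \<Sum>j<k. norm (X i j))"
  proof (intro sum_mono)
    fix i
    have "norm (X i j *v v j) \<le> norm (X i j)" if "j < k" for j
    proof -
      have "norm (v j) \<le> 1" using norm_le_bnorm[OF that] v by (rule order_trans)
      then have "norm (X i j) * norm (v j) \<le> norm (X i j)"
        by (simp add: mult_left_le)
      with norm_matrix_vector_mult_le show ?thesis by (rule order_trans)
    qed
    then show "norm (bapply k X v i) \<le> (\<Sum>j<k. norm (X i j))"
      unfolding bapply_def by (auto intro: sum_norm_le)
  qed
  finally show "bnorm k (bapply k X v) \<le> (\<Sum>i<k. \<Sum>j<k. norm (X i j))" .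
qed

lemma bnorm_bapply_le: "bnorm k (bapply k X v) \<le> bopnorm k X * bnorm k v"
proof (cases "bnorm k v = 0")
  case True
  then have "v i = 0" if "i < k" for i
    using norm_le_bnorm[OF that, of v] by simp
  \<comment> \<open>Although \<open>v\<close> may be nonzero at indices from \<open>k\<close> on,
    \<open>bapply\<close> reads only those below \<open>k\<close>.\<close>
  then have "bapply k X v = (\<lambda>i. 0)"
    by (auto simp: bapply_def)
  then show ?thesis using True by (simp add: bnorm_def)
next
  case False
  define c where "c = bnorm k v"
  have c: "c > 0" using False bnorm_nonneg[of k v] by (simp add: c_def)
  have "bnorm k (bapply k X (\<lambda>i. inverse c *\<^sub>R v i)) \<le> bopnorm k X"
    unfolding bopnorm_def
  proof (rule cSup_upper[OF _ bdd_above_bopnorm])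
    have "bnorm k (\<lambda>i. inverse c *\<^sub>R v i) \<le> 1"
      unfolding bnorm_scaleR using c by (simp add: c_def[symmetric])
    then show "bnorm k (bapply k X (\<lambda>i. inverse c *\<^sub>R v i))
        \<in> {bnorm k (bapply k X v) | v. bnorm k v \<le> 1}"
      by blast
  qed
  then show ?thesis
    using c by (simp add: bapply_scaleR bnorm_scaleR c_def[symmetric] field_simps)
qed

lemma bopnorm_le:
  assumes "\<And>v. bnorm k (bapply k X v) \<le> b * bnorm k v" "0 \<le> b"
  shows "bopnorm k X \<le> b"
  unfolding bopnorm_def
proof (rule cSup_least)
  have "bnorm k (\<lambda>_. 0) \<le> 1" by (simp add: bnorm_def)
  then show "{bnorm k (bapply k X v) | v. bnorm k v \<le> 1} \<noteq> {}" by blast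
next
  fix y assume "y \<in> {bnorm k (bapply k X v) | v. bnorm k v \<le> 1}"
  then obtain v where "y = bnorm k (bapply k X v)" "bnorm k v \<le> 1" by blast
  with assms(1)[of v] mult_left_le[OF this(2) assms(2)] show "y \<le> b" by simp
qed

lemma bopnorm_nonneg: "0 \<le> bopnorm k X"
proof -
  have "bnorm k (bapply k X (\<lambda>_. 0)) \<le> bopnorm k X"
    unfolding bopnorm_def
    by (rule cSup_upper[OF _ bdd_above_bopnorm]) (force simp: bnorm_def)
  with bnorm_nonneg show ?thesis by (rule order_trans)
qed

text \<open>An explicit bound at all block sizes at once. It combines directly under differences and
  scalings, whereas \<open>cb_norm\<close> is a real \<open>Sup\<close> whose set must first be
  shown bounded.\<close>

definition cb_bounded :: "real \<Rightarrow> ('n::finite cmat \<Rightarrow> 'n cmat) \<Rightarrow> bool" where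
  "cb_bounded b T \<longleftrightarrow>
    (\<forall>k X v. bnorm k (bapply k (\<lambda>i j. T (X i j)) v) \<le> b * bopnorm k X * bnorm k v)"

lemma bopnorm_le_of_cb_bounded:
  assumes "cb_bounded b T" "0 \<le> b" "bopnorm k X \<le> 1"
  shows "bopnorm k (\<lambda>i j. T (X i j)) \<le> b"
proof -
  have "bopnorm k (\<lambda>i j. T (X i j)) \<le> b * bopnorm k X"
    using assms by (intro bopnorm_le) (auto simp: cb_bounded_def bopnorm_nonneg)
  also have "\<dots> \<le> b" using assms by (intro mult_left_le) auto
  finally show ?thesis .
qed

lemma cb_norm_le:
  fixes T :: "'n::finite cmat \<Rightarrow> 'n cmat"
  assumes "cb_bounded b T" "0 \<le> b"
  shows "cb_norm T \<le> b"
  unfolding cb_norm_def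
proof (rule cSup_least)
  have "bopnorm 1 (\<lambda>_ _. 0 :: 'n cmat) \<le> 1"
    by (rule bopnorm_le) (auto simp: bnorm_def bapply_def)
  then show "{bopnorm k (\<lambda>i j. T (X i j)) | k X. 1 \<le> k \<and> bopnorm k X \<le> 1} \<noteq> {}"
    by blast
next
  fix y assume "y \<in> {bopnorm k (\<lambda>i j. T (X i j)) | k X. 1 \<le> k \<and> bopnorm k X \<le> 1}"
  then show "y \<le> b" using bopnorm_le_of_cb_bounded[OF assms] by blast
qed

text \<open>The value \<open>b\<close> only guarantees that the supremum is over a bounded set, so
  any finite bound gives access to \<open>cb_norm\<close> itself.\<close>

lemma bopnorm_le_cb_norm:
  assumes "cb_bounded b T" "0 \<le> b" "1 \<le> k" "bopnorm k X \<le> 1"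
  shows "bopnorm k (\<lambda>i j. T (X i j)) \<le> cb_norm T"
  unfolding cb_norm_def
proof (rule cSup_upper)
  show "bdd_above {bopnorm k (\<lambda>i j. T (X i j)) | k X. 1 \<le> k \<and> bopnorm k X \<le> 1}"
    using bopnorm_le_of_cb_bounded[OF assms(1,2)] by (intro bdd_aboveI) blast
qed (use assms in blast)

lemma cb_bounded_diff:
  assumes "cb_bounded a S" "cb_bounded b T"
  shows "cb_bounded (a + b) (\<lambda>x. S x - T x)"
  unfolding cb_bounded_def
proof (intro allI)
  fix k X and v :: "nat \<Rightarrow> complex^'a"
  let ?S = "bapply k (\<lambda>i j. S (X i j)) v" and ?T = "bapply k (\<lambda>i j. T (X i j)) v"
  have "bapply k (\<lambda>i j. S (X i j) - T (X i j)) v = (\<lambda>i. ?S i + (-1) *\<^sub>R ?T i)"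
    by (simp add: bapply_def fun_eq_iff matrix_vector_mult_diff_rdistrib sum_subtractf)
  then have "bnorm k (bapply k (\<lambda>i j. S (X i j) - T (X i j)) v) \<le> bnorm k ?S + bnorm k ?T"
    using bnorm_triangle[of k ?S "\<lambda>i. (-1) *\<^sub>R ?T i"] bnorm_scaleR[of k "-1" ?T] by simp
  also have "\<dots> \<le> a * bopnorm k X * bnorm k v + b * bopnorm k X * bnorm k v"
    using assms unfolding cb_bounded_def by (blast intro: add_mono)
  finally show "bnorm k (bapply k (\<lambda>i j. S (X i j) - T (X i j)) v)
      \<le> (a + b) * bopnorm k X * bnorm k v"
    by (simp add: algebra_simps)
qed

lemma cb_bounded_scaleR:
  assumes "cb_bounded b T" "0 \<le> c"
  shows "cb_bounded (c * b) (\<lambda>x. c *\<^sub>R T x)"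
  unfolding cb_bounded_def
proof (intro allI)
  fix k X and v :: "nat \<Rightarrow> complex^'a"
  have "bapply k (\<lambda>i j. c *\<^sub>R T (X i j)) v = (\<lambda>i. c *\<^sub>R bapply k (\<lambda>i j. T (X i j)) v i)"
    by (simp add: bapply_def scaleR_matrix_vector_mult scaleR_sum_right)
  then have "bnorm k (bapply k (\<lambda>i j. c *\<^sub>R T (X i j)) v)
      = c * bnorm k (bapply k (\<lambda>i j. T (X i j)) v)"
    using assms(2) by (simp add: bnorm_scaleR)
  also have "\<dots> \<le> c * (b * bopnorm k X * bnorm k v)"
    using assms unfolding cb_bounded_def by (blast intro: mult_left_mono)
  finally show "bnorm k (bapply k (\<lambda>i j. c *\<^sub>R T (X i j)) v) \<le> c * b * bopnorm k X * bnorm k v"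
    by (simp add: mult.assoc)
qed

text \<open>The inner product here is the real one, the real part of the Hermitian product. The
  conjugate transpose is adjoint for it as well, so Cauchy-Schwarz can be used over the reals
  throughout.\<close>

lemma matrix_vector_mult_inner: "(A *v x) \<bullet> y = x \<bullet> (adj A *v y)"
proof -
  have "(A *v x) \<bullet> y = (\<Sum>i\<in>UNIV. \<Sum>j\<in>UNIV. Re (A $ i $ j * x $ j * cnj (y $ i)))"
    by (simp add: inner_vec_def matrix_vector_mult_def inner_complex_def sum_distrib_right
        sum.distrib[symmetric] flip: sum_subtractf)
  also have "\<dots> = (\<Sum>j\<in>UNIV. \<Sum>i\<in>UNIV. Re (A $ i $ j * x $ j * cnj (y $ i)))"
    by (rule sum.swap)
  also have "\<dots> = x \<bullet> (adj A *v y)"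
    by (simp add: inner_vec_def matrix_vector_mult_def inner_complex_def sum_distrib_left
        adj_def sum.distrib[symmetric] algebra_simps)
  finally show ?thesis .
qed

lemma sum_matrix_vector_mult: "(\<Sum>a\<in>S. A a) *v x = (\<Sum>a\<in>S. A a *v (x :: complex^'n))"
  by (induction S rule: infinite_finite_induct) (auto simp: matrix_vector_mult_add_rdistrib)

lemma matrix_vector_mult_sum: "A *v (\<Sum>a\<in>S. x a) = (\<Sum>a\<in>S. A *v (x a :: complex^'n))"
  by (induction S rule: infinite_finite_induct) (auto simp: matrix_vector_right_distrib)

text \<open>Pairing the Kraus map against a second vector gives
  \<open>\<Sum>a. \<langle>V a w, X (V a v)\<rangle>\<close>, and Cauchy--Schwarz over the index \<open>a\<close> bounds this because
  both column families have the norms of \<open>w\<close> and \<open>v\<close>.\<close>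
lemma cb_bounded_kraus:
  fixes V :: "'a \<Rightarrow> 'n::finite cmat"
  assumes unital: "(\<Sum>a\<in>S. adj (V a) ** V a) = mat 1"
  shows "cb_bounded 1 (\<lambda>x. \<Sum>a\<in>S. adj (V a) ** x ** V a)"
  unfolding cb_bounded_def
proof (intro allI)
  fix k X and v :: "nat \<Rightarrow> complex^'n"
  have isometry: "(\<Sum>a\<in>S. (bnorm k (\<lambda>i. V a *v u i))\<^sup>2) = (bnorm k u)\<^sup>2" for u
  proof -
    have "(\<Sum>a\<in>S. (bnorm k (\<lambda>i. V a *v u i))\<^sup>2)
        = (\<Sum>i<k. \<Sum>a\<in>S. u i \<bullet> ((adj (V a) ** V a) *v u i))"
      unfolding power2_bnorm
      by (subst sum.swap) (simp add: matrix_vector_mult_inner matrix_vector_mul_assoc)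
    also have "\<dots> = (\<Sum>i<k. u i \<bullet> ((\<Sum>a\<in>S. adj (V a) ** V a) *v u i))"
      by (simp add: sum_matrix_vector_mult inner_sum_right)
    finally show ?thesis by (simp add: unital power2_bnorm)
  qed
  let ?T = "\<lambda>x. \<Sum>a\<in>S. adj (V a) ** x ** V a"
  \<comment> \<open>Choosing the image itself as the second vector turns the bound on the pairing
    into a bound on its norm, after cancelling one factor \<open>bnorm k w\<close>.\<close>
  define w where "w = bapply k (\<lambda>i j. ?T (X i j)) v"
  have w: "w i = (\<Sum>a\<in>S. adj (V a) *v bapply k X (\<lambda>j. V a *v v j) i)" for i
  proof -
    have "w i = (\<Sum>j<k. \<Sum>a\<in>S. adj (V a) *v (X i j *v (V a *v v j)))"
      by (simp add: w_def bapply_def sum_matrix_vector_mult matrix_vector_mul_assoc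
          matrix_mul_assoc)
    also have "\<dots> = (\<Sum>a\<in>S. \<Sum>j<k. adj (V a) *v (X i j *v (V a *v v j)))"
      by (rule sum.swap)
    finally show ?thesis
      by (simp add: bapply_def matrix_vector_mult_sum)
  qed
  have "(bnorm k w)\<^sup>2 = (\<Sum>i<k. w i \<bullet> (\<Sum>a\<in>S. adj (V a) *v bapply k X (\<lambda>j. V a *v v j) i))"
    by (simp add: power2_bnorm flip: w)
  also have "\<dots> = (\<Sum>a\<in>S. \<Sum>i<k. (V a *v w i) \<bullet> bapply k X (\<lambda>j. V a *v v j) i)"
    by (subst sum.swap) (simp add: inner_sum_right matrix_vector_mult_inner)
  also have "\<dots> \<le> (\<Sum>a\<in>S. bnorm k (\<lambda>i. V a *v w i) * bnorm k (bapply k X (\<lambda>j. V a *v v j)))"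
    by (intro sum_mono sum_inner_le_bnorm)
  also have "\<dots> \<le> (\<Sum>a\<in>S. bnorm k (\<lambda>i. V a *v w i) * (bopnorm k X * bnorm k (\<lambda>j. V a *v v j)))"
    by (intro sum_mono mult_left_mono bnorm_bapply_le bnorm_nonneg)
  also have "\<dots> = bopnorm k X * (\<Sum>a\<in>S. \<bar>bnorm k (\<lambda>i. V a *v w i)\<bar> * \<bar>bnorm k (\<lambda>j. V a *v v j)\<bar>)"
    by (simp add: sum_distrib_left bnorm_nonneg mult_ac)
  also have "\<dots> \<le> bopnorm k X * (L2_set (\<lambda>a. bnorm k (\<lambda>i. V a *v w i)) S
      * L2_set (\<lambda>a. bnorm k (\<lambda>i. V a *v v i)) S)"
    by (intro mult_left_mono L2_set_mult_ineq bopnorm_nonneg)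
  also have "\<dots> = bopnorm k X * (bnorm k w * bnorm k v)"
    by (simp add: L2_set_def isometry bnorm_nonneg)
  finally have "bnorm k w * bnorm k w \<le> bnorm k w * (bopnorm k X * bnorm k v)"
    by (simp add: power2_eq_square mult_ac)
  then have "bnorm k w \<le> bopnorm k X * bnorm k v"
    using bnorm_nonneg[of k w] bnorm_nonneg[of k v] bopnorm_nonneg[of k X]
    by (cases "bnorm k w = 0") auto
  then show "bnorm k (bapply k (\<lambda>i j. ?T (X i j)) v) \<le> 1 * bopnorm k X * bnorm k v"
    by (simp add: w_def)
qed

subsection \<open>Kraus decompositions\<close>

definition munit :: "'n::finite \<Rightarrow> 'n \<Rightarrow> 'n cmat" where
  "munit i j = (\<chi> a b. if a = i then if b = j then 1 else 0 else 0)"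

lemma adj_munit: "adj (munit i j) = munit j i"
  by (simp add: adj_def munit_def vec_eq_iff)

lemma munit_sandwich_nth:
  "(munit i j ** x ** munit k l) $ a $ b = (if a = i then if b = l then x $ j $ k else 0 else 0)"
  by (simp add: matrix_matrix_mult_def munit_def if_distrib[where f = "\<lambda>z. z * _"]
      if_distrib[where f = "\<lambda>z. _ * z"] cong: if_cong)

lemma adj_diff: "adj (A - B) = adj A - adj B"
  by (simp add: adj_def vec_eq_iff)

lemma adj_scaleR: "adj (c *\<^sub>R A) = c *\<^sub>R adj A"
  by (simp add: adj_def vec_eq_iff)

lemma scaleR_matrix_mult: "(c *\<^sub>R A) ** B = c *\<^sub>R (A ** (B :: 'n::finite cmat))"
  by (simp add: vec_eq_iff matrix_matrix_mult_def scaleR_sum_right)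

lemma matrix_mult_scaleR: "A ** (c *\<^sub>R B) = c *\<^sub>R (A ** (B :: 'n::finite cmat))"
  by (simp add: vec_eq_iff matrix_matrix_mult_def scaleR_sum_right)

lemma matrix_diff_sandwich:
  "(A - B) ** x ** (C - D) = A ** x ** C - A ** x ** D - B ** x ** C + B ** x ** (D :: 'n::finite cmat)"
  by (simp add: vec_eq_iff matrix_matrix_mult_def algebra_simps sum.distrib sum_subtractf)

text \<open>The index runs over ordered pairs, so every antisymmetrised matrix unit occurs twice up
  to sign; this explains the 2 under the root. Diagonal pairs give zero.\<close>

definition werner_kraus :: "'n::finite \<times> 'n \<Rightarrow> 'n cmat" where
  "werner_kraus = (\<lambda>(i, j). (1 / sqrt (2 * (real CARD('n) - 1))) *\<^sub>R (munit i j - munit j i))"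

text \<open>When the sandwich is expanded, the terms \<open>x $ i $ i\<close> at
  \<open>munit j j\<close> and their mirror images sum to twice the trace part, and the two cross
  terms to twice the transpose.\<close>

lemma werner_minus_kraus:
  fixes x :: "'n::finite cmat"
  assumes "CARD('n) \<ge> 2"
  shows "werner_minus x = (\<Sum>e\<in>UNIV. adj (werner_kraus e) ** x ** werner_kraus e)"
proof -
  define c where "c = 1 / (2 * (real CARD('n) - 1))"
  define r where "r = 1 / sqrt (2 * (real CARD('n) - 1))"
  have kraus: "werner_kraus e = r *\<^sub>R (munit (fst e) (snd e) - munit (snd e) (fst e))"
    for e :: "'n \<times> 'n"
    by (simp add: werner_kraus_def r_def case_prod_beta)
  have c: "r * r = c"
    using assms by (simp add: c_def r_def)
  have "(\<Sum>e\<in>UNIV. adj (werner_kraus e) ** x ** werner_kraus e)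
      = (\<Sum>i\<in>UNIV. \<Sum>j\<in>UNIV. c *\<^sub>R
          ((munit j i - munit i j) ** x ** (munit i j - munit j i)))"
    by (simp add: kraus adj_scaleR adj_diff adj_munit scaleR_matrix_mult
        matrix_mult_scaleR c sum.cartesian_product UNIV_Times_UNIV[symmetric] case_prod_beta
        del: UNIV_Times_UNIV)
  also have "\<dots> = c *\<^sub>R (2 *\<^sub>R (mat (mtrace x) - transpose x))"
  proof -
    have sum_if: "(\<Sum>j\<in>UNIV. if P then f j else 0) = (if P then \<Sum>j\<in>UNIV. f j else 0)"
      for P and f :: "'n \<Rightarrow> complex"
      by simp
    have "(\<Sum>i\<in>UNIV. \<Sum>j\<in>UNIV. (munit j i - munit i j) ** x ** (munit i j - munit j i))
        = 2 *\<^sub>R (mat (mtrace x) - transpose x)"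
      by (simp add: vec_eq_iff matrix_diff_sandwich munit_sandwich_nth mat_def mtrace_def
          transpose_def sum.distrib sum_subtractf sum_if scaleR_2)
    then show ?thesis by (simp flip: scaleR_sum_right)
  qed
  also have "\<dots> = werner_minus x"
  proof -
    have "c * 2 = 1 / (real CARD('n) - 1)"
      using assms by (simp add: c_def field_simps)
    then show ?thesis by (simp add: werner_minus_def del: scaleR_left_diff_distrib)
  qed
  finally show ?thesis by simp
qed

lemma werner_minus_one:
  assumes "CARD('n::finite) \<ge> 2"
  shows "werner_minus (mat 1 :: 'n cmat) = mat 1"
proof -
  have "of_nat CARD('n) - 1 = complex_of_real (real CARD('n) - 1)" by simp
  then have "(1 / (real CARD('n) - 1)) *\<^sub>R (of_nat CARD('n) - 1) = (1 :: complex)"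
    using assms by (simp only: scaleR_conv_of_real flip: of_real_mult) simp
  then show ?thesis
    by (auto simp: werner_minus_def vec_eq_iff mat_def mtrace_def transpose_def)
qed

lemma cb_bounded_werner_minus:
  assumes "CARD('n::finite) \<ge> 2"
  shows "cb_bounded 1 (werner_minus :: 'n cmat \<Rightarrow> 'n cmat)"
proof -
  \<comment> \<open>Evaluating the Kraus form at the identity turns unitality of the map into the
    completeness relation of its Kraus operators.\<close>
  have "(\<Sum>e\<in>UNIV. adj (werner_kraus e) ** werner_kraus e) = (mat 1 :: 'n cmat)"
    using werner_minus_kraus[OF assms, of "mat 1"] werner_minus_one[OF assms] by simp
  from cb_bounded_kraus[OF this] show ?thesis
    by (simp flip: werner_minus_kraus[OF assms])
qed

definition diag_part :: "'n::finite cmat \<Rightarrow> 'n cmat" where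
  "diag_part x = (\<chi> i j. if i = j then x $ i $ i else 0)"

lemma diag_part_kraus: "diag_part x = (\<Sum>i\<in>UNIV. adj (munit i i) ** x ** munit i i)"
  by (simp add: diag_part_def vec_eq_iff adj_munit munit_sandwich_nth)

lemma cb_bounded_diag_part: "cb_bounded 1 (diag_part :: 'n::finite cmat \<Rightarrow> 'n cmat)"
proof -
  have "diag_part (mat 1) = (mat 1 :: 'n cmat)"
    by (simp add: diag_part_def vec_eq_iff mat_def)
  then have "(\<Sum>i\<in>UNIV. adj (munit i i) ** munit i i) = (mat 1 :: 'n cmat)"
    by (simp add: diag_part_kraus)
  from cb_bounded_kraus[OF this] show ?thesis
    by (simp flip: diag_part_kraus)
qed

text \<open>The matrices \<open>sqrt (c i) *\<^sub>R u i\<close> are Kraus operators of the mixture,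
  complete because the weights sum to one.\<close>

lemma cb_bounded_conv_maps_Aut:
  assumes "R \<in> conv_maps (Aut :: ('n::finite cmat \<Rightarrow> 'n cmat) set)"
  shows "cb_bounded 1 R"
proof -
  obtain I c f where I: "finite (I :: nat set)" "\<forall>i\<in>I. 0 \<le> c i \<and> f i \<in> (Aut :: ('n cmat \<Rightarrow> _) set)"
      "(\<Sum>i\<in>I. c i) = 1" and R: "R = (\<lambda>x. \<Sum>i\<in>I. c i *\<^sub>R f i x)"
    using assms unfolding conv_maps_def by blast
  have "\<forall>i\<in>I. \<exists>u. unitary u \<and> f i = (\<lambda>x. adj u ** x ** u)"
    using I unfolding Aut_def by blast
  then obtain u where u: "\<And>i. i \<in> I \<Longrightarrow> unitary (u i)" "\<And>i. i \<in> I \<Longrightarrow> f i = (\<lambda>x. adj (u i) ** x ** u i)"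
    by metis
  define V where "V i = sqrt (c i) *\<^sub>R u i" for i
  have V: "adj (V i) ** x ** V i = c i *\<^sub>R (adj (u i) ** x ** u i)" if "i \<in> I" for i x
    using I(2) that by (simp add: V_def adj_scaleR scaleR_matrix_mult matrix_mult_scaleR)
  have "adj (V i) ** V i = c i *\<^sub>R mat 1" if "i \<in> I" for i
    using V[OF that, of "mat 1"] u(1)[OF that] by (simp add: unitary_def)
  then have "(\<Sum>i\<in>I. adj (V i) ** V i) = mat 1"
    using I(3) by (simp flip: scaleR_sum_left)
  from cb_bounded_kraus[OF this] show ?thesis
    by (simp add: R u(2) V)
qed

subsection \<open>The upper bound\<close>

text \<open>Convex combinations in \<open>conv_maps\<close> are indexed by natural numbers, so the
  set \<open>A\<close> is enumerated first.\<close>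

lemma average_in_conv_maps:
  assumes "finite A" "A \<noteq> {}" "\<And>a. a \<in> A \<Longrightarrow> f a \<in> S"
  shows "(\<lambda>x. \<Sum>a\<in>A. (1 / real (card A)) *\<^sub>R f a x) \<in> conv_maps S"
proof -
  obtain h where h: "bij_betw h {0..<card A} A"
    using ex_bij_betw_nat_finite[OF assms(1)] by blast
  have "(\<lambda>x. \<Sum>a\<in>A. (1 / real (card A)) *\<^sub>R f a x)
      = (\<lambda>x. \<Sum>i\<in>{0..<card A}. (1 / real (card A)) *\<^sub>R f (h i) x)"
    by (simp add: sum.reindex_bij_betw[OF h, of "\<lambda>a. (1 / real (card A)) *\<^sub>R f a _"])
  moreover have "{0..<card A} \<noteq> {}" "(\<Sum>i\<in>{0..<card A}. 1 / real (card A)) = 1"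
    using assms(1,2) by (auto simp: card_gt_0_iff)
  moreover have "\<forall>i\<in>{0..<card A}. 0 \<le> 1 / real (card A) \<and> f (h i) \<in> S"
    using bij_betwE[OF h] assms(3) by auto
  ultimately show ?thesis
    unfolding conv_maps_def by (intro CollectI exI conjI) (assumption | simp)+
qed

section \<open>Residues modulo \<open>n\<close>, roots of unity and matching unitaries\<close>

lemma add_mod_left_cancel_less:
  fixes a b c n :: nat
  assumes "(a + b) mod n = (a + c) mod n" "b < n" "c < n"
  shows "b = c"
  using assms
proof (induction b c rule: linorder_wlog)
  case (le b c)
  then have "n dvd (a + c) - (a + b)"
    using mod_eq_dvd_iff_nat[of "a + b" "a + c" n] by simp
  then have "n dvd c - b" by simp
  with le show ?case using dvd_imp_le[of n "c - b"] by fastforce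
qed simp

text \<open>Cancelling the common minimum from the sums leaves equal maxima, and minimum and maximum
  determine an unordered pair. Thus an edge is known from its matching and its smaller
  endpoint.\<close>

lemma same_min_and_sum_mod_iff:
  fixes a b c d n :: nat
  assumes "a < n" "b < n" "c < n" "d < n"
  shows "(a + b) mod n = (c + d) mod n \<and> min a b = min c d \<longleftrightarrow> a = c \<and> b = d \<or> a = d \<and> b = c"
  (is "?L \<longleftrightarrow> ?R")
proof
  assume L: ?L
  have "(min a b + max a b) mod n = (min a b + max c d) mod n"
    using L by (metis add.commute max_def min_def)
  then have "max a b = max c d"
    by (rule add_mod_left_cancel_less) (use assms in auto)
  with L show ?R by (auto simp: min_def max_def split: if_splits)
qed (auto simp: add.commute min.commute)

definition unity_root :: "nat \<Rightarrow> nat \<Rightarrow> complex" where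
  "unity_root n m = exp (2 * of_real pi * \<i> * of_nat m / of_nat n)"

lemma norm_unity_root: "norm (unity_root n m) = 1"
  by (simp add: unity_root_def)

lemma unity_root_mult_cnj: "cnj (unity_root n m) * unity_root n m = 1"
  by (metis complex_norm_square mult.commute norm_unity_root of_real_1 power_one)

text \<open>Character orthogonality on the cyclic group: for distinct \<open>m\<close> and
  \<open>m'\<close> the ratio \<open>z\<close> is an \<open>n\<close>-th root of unity other than 1,
  so its geometric sum vanishes.\<close>

lemma unity_root_orthogonal:
  assumes "m < n" "m' < n"
  shows "(\<Sum>t<n. cnj (unity_root n m ^ t) * unity_root n m' ^ t) = (if m = m' then of_nat n else 0)"
proof (cases "m = m'")
  case True
  then show ?thesis
    by (simp add: unity_root_mult_cnj flip: power_mult_distrib)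
next
  case False
  define z where "z = cnj (unity_root n m) * unity_root n m'"
  have n: "n \<ge> 1" using assms by simp
  have "z \<noteq> 1"
  proof
    assume "z = 1"
    have "unity_root n m' = (cnj (unity_root n m) * unity_root n m) * unity_root n m'"
      by (simp add: unity_root_mult_cnj)
    also have "\<dots> = unity_root n m * z"
      by (simp only: z_def mult_ac)
    finally have "unity_root n m' = unity_root n m"
      using \<open>z = 1\<close> by simp
    then have "m' mod n = m mod n"
      using complex_root_unity_eq[OF n, of m' m] by (simp add: unity_root_def)
    then show False using False assms by simp
  qed
  moreover have "z ^ n = 1"
    using complex_root_unity[of n] n
    by (simp add: z_def unity_root_def power_mult_distrib flip: complex_cnj_power)
  ultimately have "(\<Sum>t<n. z ^ t) = 0"
    by (simp add: geometric_sum)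
  then show ?thesis using False by (simp add: z_def power_mult_distrib)
qed

text \<open>For a numbering \<open>p\<close> of the indices by \<open>\<int>/n\<close>, the pairs with \<open>p i + p j = c\<close> form a
  near-perfect matching when \<open>n\<close> is odd, and these \<open>n\<close> matchings partition all pairs. Within one
  matching an edge is identified by its smaller endpoint, so the phases make the edges orthogonal
  when averaged over \<open>t\<close>. The sign makes the off-diagonal part antisymmetric.\<close>
definition matching_unitary :: "('n::finite \<Rightarrow> nat) \<Rightarrow> nat \<Rightarrow> nat \<Rightarrow> 'n cmat" where
  "matching_unitary p c t = (\<chi> i j. if (p i + p j) mod CARD('n) = c
     then (if p i \<le> p j then 1 else -1) * unity_root CARD('n) (min (p i) (p j)) ^ t else 0)"

context
  fixes p :: "'n::finite \<Rightarrow> nat"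
  assumes p: "bij_betw p UNIV {..<CARD('n)}"
begin

lemma numbering_less: "p i < CARD('n)"
  using bij_betwE[OF p] by auto

lemma numbering_eq_iff: "p i = p j \<longleftrightarrow> i = j"
  using bij_betw_imp_inj_on[OF p] by (auto dest: injD)

text \<open>The matrix is monomial: each column has one nonzero entry, of modulus one, and different
  columns have different supporting rows.\<close>

lemma unitary_matching_unitary:
  assumes c: "c < CARD('n)"
  shows "unitary (matching_unitary p c t)"
proof -
  let ?u = "matching_unitary p c t"
  have "(\<Sum>i\<in>UNIV. cnj (?u $ i $ k) * ?u $ i $ l) = (if k = l then 1 else 0)" for k l
  proof (cases "k = l")
    case True
    \<comment> \<open>The row matched with column \<open>k\<close> has number \<open>c - p k\<close>
      modulo \<open>n\<close>; adding \<open>CARD('n)\<close> keeps the subtraction of naturals from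
      truncating.\<close>
    have "(c + CARD('n) - p k) mod CARD('n) \<in> p ` UNIV"
      using bij_betw_imp_surj_on[OF p] by simp
    then obtain i0 where "p i0 = (c + CARD('n) - p k) mod CARD('n)" by auto
    then have i0: "(p i0 + p k) mod CARD('n) = c"
      using c numbering_less[of k] by (simp add: mod_add_left_eq)
    have i0_iff: "(p i + p k) mod CARD('n) = c \<longleftrightarrow> i = i0" for i
      using add_mod_left_cancel_less[of "p k" "p i" "CARD('n)" "p i0"] i0 numbering_less
      by (auto simp: add.commute numbering_eq_iff)
    have "cnj (?u $ i $ k) * ?u $ i $ k = (if i = i0 then 1 else 0)" for i
      by (simp add: matching_unitary_def i0_iff unity_root_mult_cnj flip: power_mult_distrib)
    then show ?thesis using True by simp
  next
    case False
    have "cnj (?u $ i $ k) * ?u $ i $ l = 0" for i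
      using add_mod_left_cancel_less[of "p i" "p k" "CARD('n)" "p l"] numbering_less False
      by (auto simp: matching_unitary_def numbering_eq_iff)
    then show ?thesis using False by (simp only: sum.neutral_const if_False)
  qed
  then have "adj ?u ** ?u = mat 1"
    by (simp add: vec_eq_iff matrix_matrix_mult_def adj_def mat_def)
  then show ?thesis
    by (simp add: unitary_def matrix_left_right_inverse)
qed

text \<open>The sum over \<open>c\<close> forces both entries into one matching, and the sum over
  \<open>t\<close> onto one edge. The signs then give plus for equal positions and minus for
  transposed ones; a diagonal position is its own transpose and counts as plus.\<close>

lemma matching_unitary_orthogonal:
  "(\<Sum>c<CARD('n). \<Sum>t<CARD('n).
      cnj (matching_unitary p c t $ i $ k) * matching_unitary p c t $ j $ l)
    = (if i = j \<and> k = l then of_nat CARD('n) else if i = l \<and> j = k then - of_nat CARD('n) else 0)"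
proof -
  let ?n = "CARD('n)"
  define s where "s a b = (if p a \<le> p b then 1 else - 1 :: complex)" for a b :: 'n
  have s_same: "s a b * s a b = 1" for a b
    by (simp add: s_def)
  have s_flip: "s a b * s b a = - 1" if "a \<noteq> b" for a b
    using numbering_eq_iff[of a b] that by (simp add: s_def)
  define m where "m a b = min (p a) (p b)" for a b
  have "(\<Sum>c<?n. \<Sum>t<?n. cnj (matching_unitary p c t $ i $ k) * matching_unitary p c t $ j $ l)
    = (\<Sum>c<?n. if c = (p i + p k) mod ?n then if (p j + p l) mod ?n = (p i + p k) mod ?n then
        s i k * s j l * (\<Sum>t<?n. cnj (unity_root ?n (m i k) ^ t) * unity_root ?n (m j l) ^ t)
        else 0 else 0)"
    by (intro sum.cong refl) (auto simp: matching_unitary_def s_def m_def sum_negf)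
  also have "\<dots> = (if (p j + p l) mod ?n = (p i + p k) mod ?n then
        s i k * s j l * (\<Sum>t<?n. cnj (unity_root ?n (m i k) ^ t) * unity_root ?n (m j l) ^ t)
        else 0)"
    by simp
  also have "\<dots> = (if (p i + p k) mod ?n = (p j + p l) mod ?n \<and> m i k = m j l then
        s i k * s j l * of_nat ?n else 0)"
    using numbering_less by (subst unity_root_orthogonal) (auto simp: m_def min_def)
  also have "\<dots> = (if i = j \<and> k = l \<or> i = l \<and> k = j then s i k * s j l * of_nat ?n else 0)"
    unfolding m_def using same_min_and_sum_mod_iff[of "p i" ?n "p k" "p j" "p l"] numbering_less
    by (simp add: numbering_eq_iff)
  also have "\<dots> = (if i = j \<and> k = l then of_nat ?n else if i = l \<and> j = k then - of_nat ?n else 0)"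
    by (simp add: s_same s_flip)
  finally show ?thesis .
qed

text \<open>With the sums over \<open>c\<close> and \<open>t\<close> moved innermost, the
  orthogonality relation applies. It subtracts transposed entries off the diagonal only, so
  \<open>diag_part x\<close> restores the diagonal that \<open>transpose x\<close> removes.\<close>

lemma matching_unitary_average:
  "(\<Sum>(c, t)\<in>{..<CARD('n)} \<times> {..<CARD('n)}.
      adj (matching_unitary p c t) ** x ** matching_unitary p c t)
    = real CARD('n) *\<^sub>R (mat (mtrace x) - transpose x + diag_part x)" (is "?L = ?R")
proof -
  let ?u = "matching_unitary p" and ?n = "CARD('n)"
  have "?L $ k $ l = ?R $ k $ l" for k l
  proof -
    have "?L $ k $ l = (\<Sum>c<?n. \<Sum>t<?n. \<Sum>j\<in>UNIV. \<Sum>i\<in>UNIV.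
        x $ i $ j * (cnj (?u c t $ i $ k) * ?u c t $ j $ l))"
      by (simp add: sum.cartesian_product[symmetric] matrix_matrix_mult_def adj_def
          sum_distrib_left sum_distrib_right mult_ac)
    also have "\<dots> = (\<Sum>c<?n. \<Sum>j\<in>UNIV. \<Sum>t<?n. \<Sum>i\<in>UNIV.
        x $ i $ j * (cnj (?u c t $ i $ k) * ?u c t $ j $ l))"
      by (intro sum.cong refl sum.swap)
    also have "\<dots> = (\<Sum>j\<in>UNIV. \<Sum>c<?n. \<Sum>i\<in>UNIV. \<Sum>t<?n.
        x $ i $ j * (cnj (?u c t $ i $ k) * ?u c t $ j $ l))"
      by (subst sum.swap) (intro sum.cong refl sum.swap)
    also have "\<dots> = (\<Sum>j\<in>UNIV. \<Sum>i\<in>UNIV. \<Sum>c<?n. \<Sum>t<?n.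
        x $ i $ j * (cnj (?u c t $ i $ k) * ?u c t $ j $ l))"
      by (intro sum.cong refl sum.swap)
    also have "\<dots> = (\<Sum>j\<in>UNIV. \<Sum>i\<in>UNIV. x $ i $ j *
        (if i = j \<and> k = l then of_nat ?n else if i = l \<and> j = k then - of_nat ?n else 0))"
      by (simp add: matching_unitary_orthogonal flip: sum_distrib_left)
    also have "\<dots> = ?R $ k $ l"
    proof (cases "k = l")
      case True
      have "(\<Sum>i\<in>UNIV. x $ i $ j *
          (if i = j \<and> k = l then of_nat ?n else if i = l \<and> j = k then - of_nat ?n else 0))
        = of_nat ?n * x $ j $ j" for j
      proof -
        have "(\<Sum>i\<in>UNIV. x $ i $ j *
          (if i = j \<and> k = l then of_nat ?n else if i = l \<and> j = k then - of_nat ?n else 0))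
          = (\<Sum>i\<in>UNIV. if i = j then of_nat ?n * x $ j $ j else 0)"
          using True by (intro sum.cong) auto
        then show ?thesis by simp
      qed
      then show ?thesis
        using True by (simp add: mat_def mtrace_def transpose_def diag_part_def sum_distrib_left
            scaleR_conv_of_real[of _ "z :: complex" for z])
    next
      case False
      have "(\<Sum>i\<in>UNIV. x $ i $ j *
          (if i = j \<and> k = l then of_nat ?n else if i = l \<and> j = k then - of_nat ?n else 0))
        = (if j = k then - of_nat ?n * x $ l $ k else 0)" for j
      proof -
        have "(\<Sum>i\<in>UNIV. x $ i $ j *
          (if i = j \<and> k = l then of_nat ?n else if i = l \<and> j = k then - of_nat ?n else 0))
          = (\<Sum>i\<in>UNIV. if i = l then if j = k then - of_nat ?n * x $ l $ k else 0 else 0)"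
          using False by (intro sum.cong) auto
        then show ?thesis by simp
      qed
      then show ?thesis
        using False by (simp add: mat_def transpose_def diag_part_def
            scaleR_conv_of_real[of _ "z :: complex" for z])
    qed
    finally show ?thesis .
  qed
  then show ?thesis by (simp add: vec_eq_iff)
qed

end

lemma ex_conv_maps_Aut_close:
  assumes "CARD('n::finite) \<ge> 2"
  obtains R where "R \<in> conv_maps (Aut :: ('n cmat \<Rightarrow> 'n cmat) set)"
    "cb_norm (\<lambda>x. werner_minus x - R x) \<le> 2 / real CARD('n)"
proof -
  let ?n = "CARD('n)"
  obtain p where p: "bij_betw p (UNIV :: 'n set) {..<?n}"
    using ex_bij_betw_finite_nat[of "UNIV :: 'n set"] by (auto simp: atLeast0LessThan)
  let ?A = "{..<?n} \<times> {..<?n}"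
  let ?f = "\<lambda>(c, t) x. adj (matching_unitary p c t) ** x ** matching_unitary p c t"
  define R where "R x = (\<Sum>a\<in>?A. (1 / real (card ?A)) *\<^sub>R ?f a x)" for x
  have "R \<in> conv_maps Aut"
    unfolding R_def
  proof (rule average_in_conv_maps)
    show "?A \<noteq> {}" by (auto simp: lessThan_empty_iff)
    show "?f a \<in> Aut" if "a \<in> ?A" for a
      using that unitary_matching_unitary[OF p] by (auto simp: Aut_def)
  qed auto
  moreover have R: "R x = (1 / real ?n) *\<^sub>R (mat (mtrace x) - transpose x + diag_part x)" for x
  proof -
    \<comment> \<open>The average is over \<open>?n * ?n\<close> unitaries, while their sum carries
      a factor \<open>?n\<close>; one factor \<open>1 / ?n\<close> remains.\<close>
    have "R x = (1 / real (?n * ?n)) *\<^sub>R (\<Sum>a\<in>?A. ?f a x)"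
      by (simp add: R_def scaleR_sum_right)
    also have "(\<Sum>a\<in>?A. ?f a x) = real ?n *\<^sub>R (mat (mtrace x) - transpose x + diag_part x)"
      using matching_unitary_average[OF p, of x] by (simp add: case_prod_beta)
    finally show ?thesis by simp
  qed
  have "werner_minus x - R x = (1 / real ?n) *\<^sub>R (werner_minus x - diag_part x)" for x
  proof -
    have "mat (mtrace x) - transpose x = (real ?n - 1) *\<^sub>R werner_minus x"
      using assms by (simp add: werner_minus_def)
    then show ?thesis
      by (simp add: R scaleR_diff_left scaleR_diff_right scaleR_add_right)
  qed
  moreover have "cb_bounded (1 / real ?n * (1 + 1))
      (\<lambda>x :: 'n cmat. (1 / real ?n) *\<^sub>R (werner_minus x - diag_part x))"
    using assms by (intro cb_bounded_scaleR cb_bounded_diff cb_bounded_werner_minus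
        cb_bounded_diag_part) auto
  ultimately show thesis
    using cb_norm_le[of "1 / real ?n * (1 + 1)" "\<lambda>x. werner_minus x - R x"]
    by (intro that[of R]) auto
qed

subsection \<open>The lower bound\<close>

text \<open>The real part of the quadratic form of the flip, with \<open>T\<close> applied to its
  blocks, at the unnormalised maximally entangled vector.\<close>

definition flip_pairing :: "('n::finite cmat \<Rightarrow> 'n cmat) \<Rightarrow> real" where
  "flip_pairing T = (\<Sum>a\<in>UNIV. \<Sum>b\<in>UNIV. Re (T (munit b a) $ a $ b))"

text \<open>The flip \<open>F\<close> permutes coordinates and so has norm at most one, while the
  entangled vector \<open>w\<close> has squared norm \<open>n\<close>; Cauchy-Schwarz gives the
  factor \<open>n\<close>.\<close>

lemma flip_pairing_le_cb_norm:
  fixes T :: "'n::finite cmat \<Rightarrow> 'n cmat"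
  assumes "cb_bounded b T" "0 \<le> b"
  shows "- flip_pairing T \<le> real CARD('n) * cb_norm T"
proof -
  let ?n = "CARD('n)"
  obtain q where q: "bij_betw q {..<?n} (UNIV :: 'n set)"
    using ex_bij_betw_nat_finite[of "UNIV :: 'n set"] by (auto simp: atLeast0LessThan)
  define F where "F i j = munit (q j) (q i)" for i j
  define w :: "nat \<Rightarrow> complex^'n" where "w i = axis (q i) 1" for i
  let ?TF = "\<lambda>i j. T (F i j)"
  have bij_sum: "(\<Sum>i<?n. h (q i)) = (\<Sum>a\<in>UNIV. h a)" for h :: "'n \<Rightarrow> real"
    by (rule sum.reindex_bij_betw[OF q])
  have power2_bnorm': "(bnorm ?n v)\<^sup>2 = (\<Sum>i<?n. \<Sum>a\<in>UNIV. (cmod (v i $ a))\<^sup>2)"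
    for v :: "nat \<Rightarrow> complex^'n"
    by (simp add: bnorm_def sum_nonneg norm_vec_def L2_set_def)
  \<comment> \<open>\<open>F\<close> exchanges the block index with the coordinate inside the block;
    \<open>q\<close> identifies the two index sets.\<close>
  have F: "bapply ?n F v i $ q j = v j $ q i" if "j < ?n" for v i j
  proof -
    have "bapply ?n F v i $ q j = (\<Sum>j'<?n. if j' = j then v j' $ q i else 0)"
      unfolding bapply_def sum_component
    proof (intro sum.cong refl)
      fix j' assume "j' \<in> {..<?n}"
      then have "q j = q j' \<longleftrightarrow> j' = j"
        using bij_betw_imp_inj_on[OF q] that by (auto dest: inj_onD)
      then show "(F i j' *v v j') $ q j = (if j' = j then v j' $ q i else 0)"
        by (simp add: F_def munit_def matrix_vector_mult_def if_distrib[where f = "\<lambda>z. z * _"]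
            cong: if_cong)
    qed
    then show ?thesis using that by simp
  qed
  have "bnorm ?n (bapply ?n F v) = bnorm ?n v" for v
  proof -
    have "(bnorm ?n (bapply ?n F v))\<^sup>2 = (\<Sum>i<?n. \<Sum>j<?n. (cmod (bapply ?n F v i $ q j))\<^sup>2)"
      by (simp add: power2_bnorm' bij_sum[of "\<lambda>a. (cmod (y $ a))\<^sup>2" for y])
    also have "\<dots> = (\<Sum>i<?n. \<Sum>j<?n. (cmod (v j $ q i))\<^sup>2)"
      by (intro sum.cong refl) (simp add: F)
    also have "\<dots> = (\<Sum>j<?n. \<Sum>i<?n. (cmod (v j $ q i))\<^sup>2)"
      by (rule sum.swap)
    also have "\<dots> = (bnorm ?n v)\<^sup>2"
      by (simp add: power2_bnorm' bij_sum[of "\<lambda>a. (cmod (y $ a))\<^sup>2" for y])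
    finally show ?thesis
      by (simp add: bnorm_nonneg)
  qed
  then have "bopnorm ?n F \<le> 1"
    by (intro bopnorm_le) auto
  then have TF: "bopnorm ?n ?TF \<le> cb_norm T"
    using assms by (intro bopnorm_le_cb_norm) (auto simp: Suc_le_eq)
  have w: "bnorm ?n w = sqrt (real ?n)"
    by (simp add: bnorm_def w_def)
  have axis_mult: "(A *v axis b 1) $ a = A $ a $ b" for A :: "'n cmat" and a b
    by (simp add: matrix_vector_mult_def axis_def if_distrib[where f = "\<lambda>z. _ * z"] cong: if_cong)
  have pairing: "w i \<bullet> bapply ?n ?TF w i = (\<Sum>j<?n. Re (T (munit (q j) (q i)) $ q i $ q j))" for i
    by (simp add: bapply_def w_def F_def inner_sum_right inner_axis' inner_complex_def axis_mult)
  have "- flip_pairing T = - (\<Sum>i<?n. w i \<bullet> bapply ?n ?TF w i)"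
    by (simp add: pairing flip_pairing_def
        bij_sum[of "\<lambda>a. \<Sum>b\<in>UNIV. Re (T (munit b a) $ a $ b)"]
        bij_sum[of "\<lambda>b. Re (T (munit b a) $ a $ b)" for a])
  also have "\<dots> = (\<Sum>i<?n. ((-1) *\<^sub>R w i) \<bullet> bapply ?n ?TF w i)"
    by (simp add: sum_negf)
  also have "\<dots> \<le> bnorm ?n (\<lambda>i. (-1) *\<^sub>R w i) * bnorm ?n (bapply ?n ?TF w)"
    by (rule sum_inner_le_bnorm)
  also have "\<dots> \<le> sqrt (real ?n) * (bopnorm ?n ?TF * sqrt (real ?n))"
    unfolding bnorm_scaleR using bnorm_bapply_le[of ?n ?TF w] by (simp add: w mult_left_mono)
  also have "\<dots> = real ?n * bopnorm ?n ?TF"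
    by simp
  also have "\<dots> \<le> real ?n * cb_norm T"
    using TF by (simp add: mult_left_mono)
  finally show ?thesis .
qed

text \<open>Trace and transpose cancel for \<open>a = b\<close>, and each of the
  \<open>n * (n - 1)\<close> remaining pairs contributes \<open>-1 / (n - 1)\<close>.\<close>

lemma flip_pairing_werner_minus:
  assumes "CARD('n::finite) \<ge> 2"
  shows "flip_pairing (werner_minus :: 'n cmat \<Rightarrow> 'n cmat) = - real CARD('n)"
proof -
  let ?n = "real CARD('n)"
  have tr: "mtrace (munit b a :: 'n cmat) = (if a = b then 1 else 0)" for a b
    by (simp add: mtrace_def munit_def)
  have diag: "munit b a $ b $ a = (1 :: complex)" for a b :: 'n
    by (simp add: munit_def)
  have "Re (werner_minus (munit b a :: 'n cmat) $ a $ b) = ((if a = b then 1 else 0) - 1) / (?n - 1)"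
    for a b
    by (simp add: werner_minus_def tr mat_def transpose_def diag)
  then have "flip_pairing (werner_minus :: 'n cmat \<Rightarrow> 'n cmat)
      = (\<Sum>a\<in>(UNIV :: 'n set). \<Sum>b\<in>(UNIV :: 'n set). ((if a = b then 1 else 0) - 1) / (?n - 1))"
    by (simp add: flip_pairing_def)
  also have "\<dots> = ?n * ((1 - ?n) / (?n - 1))"
    by (simp add: sum_subtractf flip: sum_divide_distrib)
  also have "\<dots> = - ?n"
    using assms by (simp add: field_simps)
  finally show ?thesis .
qed

section \<open>Unitaries in odd dimension\<close>

lemma det_antisymmetric_odd:
  fixes A :: "complex^'n::finite^'n"
  assumes "transpose A = - A" "odd CARD('n)"
  shows "det A = 0"
proof -
  have "- A = (\<chi> i. (-1) *s A $ i)"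
    by (simp add: vec_eq_iff)
  then have "det (- A) = prod (\<lambda>_. -1) (UNIV :: 'n set) * det (\<chi> i. A $ i)"
    by (simp only: det_rows_mul)
  then have "det (- A) = (-1) ^ CARD('n) * det A"
    by simp
  \<comment> \<open>Transposition preserves the determinant, while negating an odd number of rows
    changes its sign.\<close>
  then have "det A = - det A"
    using assms det_transpose[of A] by simp
  then show ?thesis by simp
qed

lemma unitary_norm_preserving:
  assumes "unitary u"
  shows "norm (u *v x) = norm x"
proof -
  have "(u *v x) \<bullet> (u *v x) = x \<bullet> x"
    using assms by (simp add: matrix_vector_mult_inner matrix_vector_mul_assoc unitary_def)
  then show ?thesis by (simp add: norm_eq_sqrt_inner)
qed

lemma power2_norm_matrix:
  fixes A :: "complex^'n::finite^'m::finite"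
  shows "(norm A)\<^sup>2 = (\<Sum>i\<in>UNIV. \<Sum>j\<in>UNIV. (cmod (A $ i $ j))\<^sup>2)"
  by (simp add: norm_vec_def L2_set_def sum_nonneg)

lemma power2_norm_unitary:
  fixes u :: "'n::finite cmat"
  assumes "unitary u"
  shows "(norm u)\<^sup>2 = real CARD('n)"
proof -
  have "(\<Sum>j\<in>UNIV. (cmod (u $ i $ j))\<^sup>2) = 1" for i
  proof -
    have "complex_of_real (\<Sum>j\<in>UNIV. (cmod (u $ i $ j))\<^sup>2) = (u ** adj u) $ i $ i"
      by (simp add: matrix_matrix_mult_def adj_def complex_norm_square
          del: of_real_power)
    also have "\<dots> = 1"
      using assms by (simp add: unitary_def mat_def)
    finally show ?thesis by (simp only: of_real_eq_1_iff)
  qed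
  then show ?thesis by (simp add: power2_norm_matrix)
qed

text \<open>In odd dimension \<open>u - transpose u\<close> is antisymmetric, hence singular; on a kernel vector the
  matrix \<open>u + transpose u\<close> acts as \<open>2 u\<close>, so its Hilbert--Schmidt norm is at least \<open>2\<close>.\<close>
lemma unitary_transpose_correlation:
  fixes u :: "'n::finite cmat"
  assumes u: "unitary u" and odd: "odd CARD('n)"
  shows "(\<Sum>a\<in>UNIV. \<Sum>b\<in>UNIV. Re (cnj (u $ b $ a) * u $ a $ b)) \<ge> 2 - real CARD('n)"
proof -
  let ?A = "u - transpose u" and ?S = "u + transpose u"
  have "det ?A = 0"
    using odd by (intro det_antisymmetric_odd) (simp_all add: vec_eq_iff transpose_def)
  then have "\<not> (\<forall>x. ?A *v x = 0 \<longrightarrow> x = 0)"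
    using matrix_left_invertible_ker[of ?A] invertible_left_inverse[of ?A] invertible_det_nz[of ?A]
    by blast
  then obtain x where x: "?A *v x = 0" "x \<noteq> 0" by blast
  then have "transpose u *v x = u *v x"
    by (simp add: matrix_vector_mult_diff_rdistrib)
  then have "?S *v x = 2 *\<^sub>R (u *v x)"
    by (simp add: matrix_vector_mult_add_rdistrib scaleR_2)
  then have "2 * norm x \<le> norm ?S * norm x"
    using norm_matrix_vector_mult_le[of ?S x] by (simp add: unitary_norm_preserving[OF u])
  then have "2 \<le> norm ?S" using x(2) by simp
  then have "2\<^sup>2 \<le> (norm ?S)\<^sup>2" by (intro power_mono) auto
  \<comment> \<open>The cross term of each squared entry is the wanted correlation, so the estimate
    becomes 4 at most \<open>2 * n\<close> plus twice the correlation.\<close>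
  also have "(norm ?S)\<^sup>2 = (\<Sum>a\<in>UNIV. \<Sum>b\<in>UNIV. (cmod (u $ a $ b))\<^sup>2 + (cmod (u $ b $ a))\<^sup>2
      + 2 * Re (cnj (u $ b $ a) * u $ a $ b))"
    unfolding power2_norm_matrix
    by (intro sum.cong refl) (simp add: transpose_def cmod_power2, simp add: power2_eq_square algebra_simps)
  also have "\<dots> = (norm u)\<^sup>2 + (\<Sum>a\<in>UNIV. \<Sum>b\<in>UNIV. (cmod (u $ b $ a))\<^sup>2)
      + 2 * (\<Sum>a\<in>UNIV. \<Sum>b\<in>UNIV. Re (cnj (u $ b $ a) * u $ a $ b))"
    unfolding power2_norm_matrix sum.distrib sum_distrib_left ..
  also have "(\<Sum>a\<in>UNIV. \<Sum>b\<in>UNIV. (cmod (u $ b $ a))\<^sup>2) = (norm u)\<^sup>2"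
    unfolding power2_norm_matrix by (rule sum.swap)
  finally show ?thesis by (simp add: power2_norm_unitary[OF u])
qed

lemma flip_pairing_Aut:
  fixes f :: "'n::finite cmat \<Rightarrow> 'n cmat"
  assumes "f \<in> Aut" "odd CARD('n)"
  shows "flip_pairing f \<ge> 2 - real CARD('n)"
proof -
  obtain u where u: "unitary u" and f: "f = (\<lambda>x. adj u ** x ** u)"
    using assms(1) unfolding Aut_def by blast
  have "f (munit b a) $ a $ b = cnj (u $ b $ a) * u $ a $ b" for a b
    by (simp add: f matrix_matrix_mult_def adj_def munit_def if_distrib[where f = "\<lambda>z. z * _"]
      if_distrib[where f = "\<lambda>z. _ * z"] cong: if_cong)
  then show ?thesis
    using unitary_transpose_correlation[OF u assms(2)] by (simp add: flip_pairing_def)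
qed

lemma flip_pairing_diff: "flip_pairing (\<lambda>x. S x - T x) = flip_pairing S - flip_pairing T"
  by (simp add: flip_pairing_def sum_subtractf)

text \<open>The pairing is real-linear in the map, so a bound valid at every automorphism survives
  weights summing to one.\<close>

lemma flip_pairing_conv_maps_Aut:
  fixes R :: "'n::finite cmat \<Rightarrow> 'n cmat"
  assumes "R \<in> conv_maps Aut" "odd CARD('n)"
  shows "flip_pairing R \<ge> 2 - real CARD('n)"
proof -
  obtain I c f where I: "finite (I :: nat set)" "\<forall>i\<in>I. 0 \<le> c i \<and> f i \<in> (Aut :: ('n cmat \<Rightarrow> _) set)"
      "(\<Sum>i\<in>I. c i) = 1" and R: "R = (\<lambda>x. \<Sum>i\<in>I. c i *\<^sub>R f i x)"
    using assms unfolding conv_maps_def by blast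
  have "flip_pairing R = (\<Sum>a\<in>UNIV. \<Sum>i\<in>I. \<Sum>b\<in>UNIV. c i * Re (f i (munit b a) $ a $ b))"
    unfolding flip_pairing_def R by (subst sum.swap) simp
  also have "\<dots> = (\<Sum>i\<in>I. c i * flip_pairing (f i))"
    by (subst sum.swap) (simp add: flip_pairing_def sum_distrib_left)
  also have "\<dots> \<ge> (\<Sum>i\<in>I. c i * (2 - real CARD('n)))"
    using I(2) assms(2) by (intro sum_mono mult_left_mono flip_pairing_Aut) auto
  finally show ?thesis
    using I(3) by (simp flip: sum_distrib_right)
qed

theorem theorem4p10:
  assumes "odd CARD('n::finite)" and "CARD('n) \<ge> 3"
  shows "d_cb (werner_minus :: 'n cmat \<Rightarrow> 'n cmat) (conv_maps Aut) = 2 / real CARD('n)"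
proof -
  let ?W = "werner_minus :: 'n cmat \<Rightarrow> 'n cmat" and ?n = "real CARD('n)"
  have n: "CARD('n) \<ge> 2" using assms by simp
  have lower: "2 / ?n \<le> cb_norm (\<lambda>x. ?W x - R x)" if R: "R \<in> conv_maps Aut" for R
  proof -
    have "cb_bounded (1 + 1) (\<lambda>x. ?W x - R x)"
      by (intro cb_bounded_diff cb_bounded_werner_minus cb_bounded_conv_maps_Aut n R)
    then have "- flip_pairing (\<lambda>x. ?W x - R x) \<le> ?n * cb_norm (\<lambda>x. ?W x - R x)"
      by (rule flip_pairing_le_cb_norm) simp
    \<comment> \<open>The pairing is \<open>- n\<close> at \<open>?W\<close> and at least
      \<open>2 - n\<close> at \<open>R\<close>, a gap of at least 2.\<close>
    moreover have "2 \<le> - flip_pairing (\<lambda>x. ?W x - R x)"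
      using flip_pairing_conv_maps_Aut[OF R assms(1)]
      by (simp add: flip_pairing_diff flip_pairing_werner_minus[OF n])
    ultimately show ?thesis
      using n by (simp add: field_simps)
  qed
  obtain R where R: "R \<in> conv_maps Aut" "cb_norm (\<lambda>x. ?W x - R x) \<le> 2 / ?n"
    using ex_conv_maps_Aut_close[OF n] by blast
  with lower[OF R(1)] have "cb_norm (\<lambda>x. ?W x - R x) = 2 / ?n" by simp
  \<comment> \<open>The bound is attained at this \<open>R\<close>, so the infimum is a
    minimum.\<close>
  with R(1) have "2 / ?n \<in> {cb_norm (\<lambda>x. ?W x - R x) | R. R \<in> conv_maps Aut}"
    by (metis (mono_tags, lifting) mem_Collect_eq)
  then show ?thesis
    unfolding d_cb_def by (rule cInf_eq_minimum) (use lower in blast)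
qed

end
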